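(* Let $0<q<1$ and $\nu>-1$ be fixed, and let $j_{1\nu}<j_{2\nu}<\cdots$ be the positive zeros of $z\mapsto J_\nu(z;q^2)$. If $f$ is a function such that $t^{\frac12}f(t)\in L_q^2[0,1]$, then $$\lim_{m\to\infty}\int_{0}^{1}t\,f(t)\,J_{\nu}(qj_{m\nu}t;q^{2})\,{\rm d}_{q}t=0 .$$
   Context: For $0<p<1$: $(a;p)_0=1$, $(a;p)_n=\prod_{i=0}^{n-1}(1-ap^i)$, $(a;p)_\infty=\lim_{n\to\infty}(a;p)_n$. The third Jackson (Hahn--Exton) $q$-Bessel function, with base $q^2$, is defined for $z>0$ by $$J_{\nu}(z;q^2)=z^{\nu}\frac{(q^{2(\nu+1)};q^2)_\infty}{(q^2;q^2)_\infty}\sum_{k=0}^{\infty}(-1)^k\frac{q^{k(k+1)}}{(q^{2(\nu+1)};q^2)_k\,(q^2;q^2)_k}z^{2k}.$$ It is known that for $\nu>-1$ its positive zeros form a countably infinite set of simple zeros, which can be listed in increasing order $j_{1\nu}<j_{2\nu}<\cdots$. The $q$-integral on $[0,1]$ is $\int_{0}^{1}g(t)\,{\rm d}_{q}t:=(1-q)\sum_{k=0}^{\infty}g(q^{k})q^{k}$. The space $L_q^2[0,1]$ consists of the complex-valued functions $g$ with $\int_0^1|g(t)|^2\,{\rm d}_qt<+\infty$, where functions agreeing at all points $q^k$, $k=0,1,2,\ldots$, are identified. *)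

theory Defs
  imports "HOL-Analysis.Analysis"
begin

definition qpoch :: "real \<Rightarrow> real \<Rightarrow> nat \<Rightarrow> real" where
  "qpoch a p n = (\<Prod>i<n. 1 - a * p ^ i)"

definition qpoch_inf :: "real \<Rightarrow> real \<Rightarrow> real" where
  "qpoch_inf a p = lim (\<lambda>n. qpoch a p n)"

(* hahn_exton q \<nu> z is J_\<nu>(z; q^2): the parameter is q, the base is q^2.
   Only meaningful for z > 0 (real powers via powr). *)
definition hahn_exton :: "real \<Rightarrow> real \<Rightarrow> real \<Rightarrow> real" where
  "hahn_exton q \<nu> z =
     z powr \<nu> * (qpoch_inf (q powr (2 * (\<nu> + 1))) (q\<^sup>2) / qpoch_inf (q\<^sup>2) (q\<^sup>2)) *
     (\<Sum>k. (-1) ^ k * (q ^ (k * (k + 1)) /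
            (qpoch (q powr (2 * (\<nu> + 1))) (q\<^sup>2) k * qpoch (q\<^sup>2) (q\<^sup>2) k)) * z ^ (2 * k))"

definition q_integral :: "real \<Rightarrow> (real \<Rightarrow> complex) \<Rightarrow> complex" where
  "q_integral q g = of_real (1 - q) * (\<Sum>k. g (q ^ k) * of_real (q ^ k))"

(* Membership depends only on the values at the points q^k, so functions are used
   as representatives in place of classes. As the terms are nonnegative, summability
   says that the q-integral of |g|^2 is finite. *)
definition Lq2 :: "real \<Rightarrow> (real \<Rightarrow> complex) set" where
  "Lq2 q = {g. summable (\<lambda>k. (cmod (g (q ^ k)))\<^sup>2 * q ^ k)}"

end

theory Submission
  imports Defs "HOL-Complex_Analysis.Complex_Analysis"
begin

text \<open>
  Let \<open>z\<close> be a positive zero of \<open>J = J\<^sub>\<nu>(\<cdot>; q\<^sup>2)\<close>. The heart of the argument is that the values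
  \<open>J (q\<^sup>n * z)\<close> are bounded by a constant multiple of \<open>1 + q powr (\<nu> n)\<close>, uniformly in \<open>z \<ge> 1\<close>,
  although \<open>J\<close> itself is not bounded by any power at infinity. This rests on the three-term
  \<open>q\<close>-difference equation
  \<open>J u + J (q\<^sup>2 u) = (q powr \<nu> + q powr -\<nu> - q powr -\<nu> * (q u)\<^sup>2) * J (q u)\<close>.
  Once \<open>q u\<close> exceeds a threshold \<open>R\<close>, the factor on the right is at least \<open>3\<close> in absolute value.
  Starting the recurrence at the zero, it follows by induction that \<open>\<bar>J (q\<^sup>n z)\<bar>\<close> at least doubles
  with every step for as long as \<open>q\<^sup>n z \<ge> R\<close>. All these values are therefore dominated by the
  values of \<open>J\<close> on the fixed interval \<open>[q R, R]\<close>, and a value that lies \<open>d\<close> steps before the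
  sequence drops below \<open>R\<close> is smaller than that bound by a factor of at least \<open>2\<^sup>d\<close>. Below the
  threshold, \<open>J u\<close> is bounded by a multiple of \<open>u powr \<nu>\<close> because it is \<open>u powr \<nu>\<close> times a
  continuous function.

  If \<open>j\<^sub>m\<close> tends to infinity, the number \<open>d\<close> of doubling steps available to a fixed index \<open>n\<close> is
  unbounded, so that \<open>J (q\<^sup>n j\<^sub>m)\<close> tends to \<open>0\<close>. The uniform bound supplies a dominating series:
  the numbers \<open>q\<^sup>k f (q\<^sup>k)\<close> are square-summable, hence bounded, and
  \<open>q\<^sup>k (1 + q powr (\<nu> (k + 1)))\<close> is summable precisely because \<open>\<nu> > -1\<close>. Tannery's theorem then
  allows the limit to be taken termwise.

  That \<open>j\<^sub>m\<close> tends to infinity holds since \<open>J\<close> is, up to the factor \<open>z powr \<nu>\<close> and a constant, an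
  entire function with value \<open>1\<close> at the origin, which has only finitely many zeros in each compact
  set. The constant cannot vanish, for otherwise every positive number would be a zero, and
  there would be no smallest one.
\<close>

section \<open>The entire part of the Hahn--Exton function\<close>

text \<open>The parameter \<open>b\<close> stands for \<open>q powr (2 * (\<nu> + 1))\<close>, and the argument of the resulting power
  series is the square of the argument of the Bessel function.\<close>

definition he_coeff :: "real \<Rightarrow> real \<Rightarrow> nat \<Rightarrow> real" where
  "he_coeff q b k = (-1) ^ k * (q ^ (k * (k + 1)) / (qpoch b (q\<^sup>2) k * qpoch (q\<^sup>2) (q\<^sup>2) k))"

definition he_series :: "real \<Rightarrow> real \<Rightarrow> real \<Rightarrow> real" where
  "he_series q b x = (\<Sum>k. he_coeff q b k * x ^ k)"

definition he_const :: "real \<Rightarrow> real \<Rightarrow> real" where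
  "he_const q \<nu> = qpoch_inf (q powr (2 * (\<nu> + 1))) (q\<^sup>2) / qpoch_inf (q\<^sup>2) (q\<^sup>2)"

lemma hahn_exton_eq:
  "hahn_exton q \<nu> z = z powr \<nu> * he_const q \<nu> * he_series q (q powr (2 * (\<nu> + 1))) (z\<^sup>2)"
  by (simp add: hahn_exton_def he_const_def he_series_def he_coeff_def power_mult)

lemma he_coeff_0 [simp]: "he_coeff q b 0 = 1"
  by (simp add: he_coeff_def qpoch_def)

lemma he_coeff_Suc:
  "he_coeff q b (Suc k) =
     - (q ^ (2 * Suc k) / ((1 - b * q ^ (2 * k)) * (1 - q ^ (2 * Suc k)))) * he_coeff q b k"
proof -
  have "q ^ (Suc k * (Suc k + 1)) = q ^ (2 * Suc k) * q ^ (k * (k + 1))"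
    unfolding power_add [symmetric] by (rule arg_cong[where f = "\<lambda>m. q ^ m"]) (simp add: algebra_simps)
  moreover have "qpoch b (q\<^sup>2) (Suc k) = qpoch b (q\<^sup>2) k * (1 - b * q ^ (2 * k))"
    by (simp add: qpoch_def power_mult)
  moreover have "qpoch (q\<^sup>2) (q\<^sup>2) (Suc k) = qpoch (q\<^sup>2) (q\<^sup>2) k * (1 - q ^ (2 * Suc k))"
    unfolding qpoch_def by (simp add: power_mult power2_eq_square)
  ultimately show ?thesis
    unfolding he_coeff_def
    by (simp only: power_Suc divide_inverse inverse_mult_distrib mult_minus_left mult_minus_right
        mult_1 mult_ac)
qed

context
  fixes q b :: real
  assumes q: "0 < q" "q < 1" and b: "0 < b" "b < 1"
begin

lemma he_factor_ge:
  "1 - b * q ^ (2 * k) \<ge> 1 - b" "1 - q ^ (2 * Suc k) \<ge> 1 - q\<^sup>2" "q\<^sup>2 < 1"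
proof -
  have "q ^ (2 * k) \<le> 1" using q by (simp add: power_le_one)
  then show "1 - b * q ^ (2 * k) \<ge> 1 - b" using b by (simp add: mult_left_le)
  have "q ^ (2 * Suc k) \<le> q ^ 2" using q by (intro power_decreasing) auto
  then show "1 - q ^ (2 * Suc k) \<ge> 1 - q\<^sup>2" by simp
  show "q\<^sup>2 < 1" using q by (simp add: power_less_one_iff)
qed

text \<open>The quotient of consecutive coefficients is \<open>O (q\<^bsup>2k\<^esup>)\<close>, so the radius of convergence is
  infinite.\<close>

lemma summable_he_series:
  fixes x :: "'a :: {real_normed_field, banach}"
  shows "summable (\<lambda>k. of_real (he_coeff q b k) * x ^ k)"
proof -
  define D where "D = (1 - b) * (1 - q\<^sup>2)"
  have D: "D > 0" using b he_factor_ge(3) by (simp add: D_def)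
  have ratio: "\<bar>he_coeff q b (Suc k)\<bar> \<le> q ^ (2 * Suc k) / D * \<bar>he_coeff q b k\<bar>" for k
  proof -
    have "D \<le> (1 - b * q ^ (2 * k)) * (1 - q ^ (2 * Suc k))"
      unfolding D_def using he_factor_ge(3) b order.trans[OF _ he_factor_ge(1), of 0 k]
      by (intro mult_mono he_factor_ge) auto
    then have "q ^ (2 * Suc k) / ((1 - b * q ^ (2 * k)) * (1 - q ^ (2 * Suc k))) \<le> q ^ (2 * Suc k) / D"
      using D q by (intro divide_left_mono) auto
    moreover have "q ^ (2 * Suc k) / ((1 - b * q ^ (2 * k)) * (1 - q ^ (2 * Suc k))) \<ge> 0"
      using \<open>D \<le> _\<close> D q by (intro divide_nonneg_nonneg) auto
    ultimately have "\<bar>- (q ^ (2 * Suc k) / ((1 - b * q ^ (2 * k)) * (1 - q ^ (2 * Suc k))))\<bar>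
                       \<le> q ^ (2 * Suc k) / D" by linarith
    then show ?thesis
      unfolding he_coeff_Suc abs_mult by (intro mult_right_mono) auto
  qed
  have "(\<lambda>k. (q\<^sup>2) ^ Suc k / D * norm x) \<longlonglongrightarrow> 0 / D * norm x"
    using he_factor_ge(3) by (intro tendsto_intros LIMSEQ_Suc LIMSEQ_power_zero) (use D in auto)
  then have "eventually (\<lambda>k. (q\<^sup>2) ^ Suc k / D * norm x < 1/2) sequentially"
    by (rule order_tendstoD) auto
  then obtain N where N: "\<And>k. k \<ge> N \<Longrightarrow> q ^ (2 * Suc k) / D * norm x < 1/2"
    unfolding eventually_sequentially by (metis power_mult)
  show ?thesis
  proof (rule summable_ratio_test[of "1/2" N])
    fix k assume "k \<ge> N"
    have "norm (of_real (he_coeff q b (Suc k)) * x ^ Suc k)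
            \<le> (q ^ (2 * Suc k) / D * \<bar>he_coeff q b k\<bar>) * norm x ^ Suc k"
      unfolding norm_mult norm_of_real norm_power using ratio[of k]
      by (rule mult_right_mono) simp
    also have "\<dots> = (q ^ (2 * Suc k) / D * norm x) * norm (of_real (he_coeff q b k) * x ^ k)"
      by (simp add: norm_mult norm_power)
    also have "\<dots> \<le> 1/2 * norm (of_real (he_coeff q b k) * x ^ k)"
      using N[OF \<open>k \<ge> N\<close>] by (intro mult_right_mono) auto
    finally show "norm (of_real (he_coeff q b (Suc k)) * x ^ Suc k)
                    \<le> 1/2 * norm (of_real (he_coeff q b k) * x ^ k)" .
  qed auto
qed

lemma summable_he_series_real: "summable (\<lambda>k. he_coeff q b k * x ^ k)"
  using summable_he_series[of x] by simp

lemma continuous_on_he_series: "continuous_on A (he_series q b)"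
  unfolding he_series_def
  by (intro continuous_at_imp_continuous_on ballI isCont_powser_converges_everywhere
        summable_he_series_real)

text \<open>The recurrence \<open>he_coeff_Suc\<close>, cleared of denominators, relates the coefficients at \<open>x\<close>, \<open>q\<^sup>2 x\<close>
  and \<open>q\<^sup>4 x\<close>, because \<open>1 - (1 + b/q\<^sup>2) y + (b/q\<^sup>2) y\<^sup>2 = (1 - y) (1 - (b/q\<^sup>2) y)\<close> for
  \<open>y = q\<^bsup>2k\<^esup>\<close>.\<close>

lemma he_series_q_difference:
  "he_series q b x + b / q\<^sup>2 * he_series q b (q ^ 4 * x) =
     (1 + b / q\<^sup>2 - q\<^sup>2 * x) * he_series q b (q\<^sup>2 * x)"
proof -
  let ?c = "he_coeff q b"
  have S: "(\<lambda>k. ?c k * y ^ k) sums he_series q b y" for y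
    unfolding he_series_def by (rule summable_sums[OF summable_he_series_real])
  define u where "u k = ?c k * x ^ k + b / q\<^sup>2 * (?c k * (q ^ 4 * x) ^ k)
                          - (1 + b / q\<^sup>2) * (?c k * (q\<^sup>2 * x) ^ k)" for k
  have u_sums: "u sums (he_series q b x + b / q\<^sup>2 * he_series q b (q ^ 4 * x)
                          - (1 + b / q\<^sup>2) * he_series q b (q\<^sup>2 * x))"
    unfolding u_def by (intro sums_add sums_diff sums_mult S)
  have u_Suc: "u (Suc k) = - (q\<^sup>2 * x) * (?c k * (q\<^sup>2 * x) ^ k)" for k
  proof -
    define y where "y = q ^ (2 * k)"
    have q_Suc: "q ^ (2 * Suc k) = q\<^sup>2 * y" by (simp add: y_def power2_eq_square)
    then have "1 - b * y > 0" "1 - q\<^sup>2 * y > 0"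
      using he_factor_ge(1,2)[of k, folded y_def] he_factor_ge(3) b by linarith+
    then have nz: "1 - b * y \<noteq> 0" "1 - q\<^sup>2 * y \<noteq> 0" by auto
    have c: "?c (Suc k) = - (q\<^sup>2 * y / ((1 - b * y) * (1 - q\<^sup>2 * y))) * ?c k"
      unfolding he_coeff_Suc by (simp only: q_Suc y_def [symmetric])
    have "(q\<^sup>2) ^ k = y" by (simp add: y_def power_mult)
    moreover have "(q ^ 4) ^ k = ((q\<^sup>2) ^ k)\<^sup>2"
      by (simp only: power_mult [symmetric]) (simp add: mult.commute)
    ultimately have p: "(q\<^sup>2 * x) ^ k = y * x ^ k" "(q ^ 4 * x) ^ k = y\<^sup>2 * x ^ k"
      by (simp_all only: power_mult_distrib)
    define s where "s = b / q\<^sup>2"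
    have b_eq: "b = s * q\<^sup>2" using q by (simp add: s_def)
    have "u (Suc k) = ?c (Suc k) * (x * x ^ k) + s * (?c (Suc k) * (q ^ 4 * x * (y\<^sup>2 * x ^ k)))
                        - (1 + s) * (?c (Suc k) * (q\<^sup>2 * x * (y * x ^ k)))"
      by (simp only: u_def s_def power_Suc p)
    also have "\<dots> = ?c (Suc k) * ((1 - b * y) * (1 - q\<^sup>2 * y)) * (x * x ^ k)"
      unfolding b_eq by algebra
    also have "\<dots> = - (q\<^sup>2 * y * ?c k) * (x * x ^ k)"
      unfolding c using nz by simp
    finally show ?thesis by (simp only: p) (simp add: mult_ac)
  qed
  have "u 0 = 0" by (simp add: u_def)
  have "(\<lambda>k. u (Suc k)) sums (- (q\<^sup>2 * x) * he_series q b (q\<^sup>2 * x))"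
    unfolding u_Suc by (intro sums_mult S)
  then have "u sums (- (q\<^sup>2 * x) * he_series q b (q\<^sup>2 * x))"
    using sums_Suc_iff[of u] \<open>u 0 = 0\<close> by simp
  from sums_unique2[OF u_sums this] show ?thesis by (simp add: algebra_simps)
qed

text \<open>The identity theorem is applied to the complex extension of the series.\<close>

lemma finite_zeros_he_series: "finite {x. \<bar>x\<bar> \<le> B \<and> he_series q b x = 0}"
proof -
  define G where "G w = (\<Sum>k. of_real (he_coeff q b k) * w ^ k)" for w :: complex
  have G_real: "G (of_real x) = of_real (he_series q b x)" for x
    unfolding G_def he_series_def
    by (subst suminf_of_real) (auto simp: summable_he_series_real)
  have G0: "G 0 = 1" by (simp add: G_def)
  have hol: "G holomorphic_on ball 0 (\<bar>B\<bar> + 1)"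
    by (rule power_series_holomorphic[where a = "\<lambda>k. of_real (he_coeff q b k)"])
       (simp add: G_def summable_sums summable_he_series)
  show ?thesis
  proof (cases "G constant_on ball 0 (\<bar>B\<bar> + 1)")
    case True
    \<comment> \<open>A constant extension equals \<open>1\<close> on the disc and then has no zeros there.\<close>
    have "he_series q b x = 1" if "\<bar>x\<bar> \<le> B" for x
    proof -
      have "of_real x \<in> ball (0::complex) (\<bar>B\<bar> + 1)" "(0::complex) \<in> ball 0 (\<bar>B\<bar> + 1)"
        using that by auto
      then have "G (of_real x) = G 0"
        using True unfolding constant_on_def by metis
      then show ?thesis unfolding G_real G0 by (simp only: of_real_eq_1_iff)
    qed
    then have "{x. \<bar>x\<bar> \<le> B \<and> he_series q b x = 0} = {}" by force
    then show ?thesis by (simp only: finite.emptyI)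
  next
    case False
    have "finite {z \<in> cball 0 \<bar>B\<bar>. G z = 0}"
      by (rule holomorphic_compact_finite_zeros[OF hol _ _ _ _ False]) auto
    then have "finite (of_real -` {z \<in> cball 0 \<bar>B\<bar>. G z = 0} :: real set)"
      by (rule finite_vimageI) (simp add: inj_of_real)
    then show ?thesis
      by (rule rev_finite_subset) (auto simp: G_real)
  qed
qed

end

section \<open>Values at the points of a geometric progression starting at a zero\<close>

text \<open>The lemmas of this section hold for every function \<open>J\<close> satisfying the three-term equation and
  being \<open>O (u powr \<nu>)\<close> on bounded intervals; the Hahn--Exton function is the intended instance.\<close>

locale q_bessel_equation =
  fixes q \<nu> :: real and J :: "real \<Rightarrow> real"
  assumes q: "0 < q" "q < 1"
    and three_term: "u > 0 \<Longrightarrow>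
          J u + J (q\<^sup>2 * u) = (q powr \<nu> + q powr -\<nu> - q powr -\<nu> * (q * u)\<^sup>2) * J (q * u)"
    and locally_bounded: "\<exists>C. \<forall>u. 0 < u \<and> u \<le> R \<longrightarrow> \<bar>J u\<bar> \<le> C * u powr \<nu>"
begin

text \<open>Beyond this threshold the factor in the three-term equation has absolute value at least \<open>3\<close>.\<close>

definition threshold :: real where
  "threshold = sqrt (q powr \<nu> * (3 + q powr \<nu> + q powr -\<nu>))"

lemma threshold_pos: "threshold > 0"
  using q by (simp add: threshold_def add_pos_pos)

lemma three_term_growth:
  assumes "u > 0" "q * u \<ge> threshold"
  shows "\<bar>J (q\<^sup>2 * u)\<bar> \<ge> 3 * \<bar>J (q * u)\<bar> - \<bar>J u\<bar>"
proof -
  let ?c = "q powr \<nu> + q powr -\<nu> - q powr -\<nu> * (q * u)\<^sup>2"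
  have "threshold\<^sup>2 \<le> (q * u)\<^sup>2"
    using assms threshold_pos by (intro power_mono) auto
  then have "q powr -\<nu> * (q powr \<nu> * (3 + q powr \<nu> + q powr -\<nu>)) \<le> q powr -\<nu> * (q * u)\<^sup>2"
    by (intro mult_left_mono) (auto simp: threshold_def)
  moreover have "q powr -\<nu> * (q powr \<nu> * x) = x" for x
    using q by (simp add: powr_minus mult.assoc[symmetric])
  ultimately have "3 + q powr \<nu> + q powr -\<nu> \<le> q powr -\<nu> * (q * u)\<^sup>2" by simp
  then have "3 \<le> \<bar>?c\<bar>" by linarith
  then have "3 * \<bar>J (q * u)\<bar> \<le> \<bar>?c * J (q * u)\<bar>"
    unfolding abs_mult by (intro mult_right_mono) auto
  also have "\<dots> = \<bar>J u + J (q\<^sup>2 * u)\<bar>" by (simp only: three_term[OF assms(1)])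
  finally show ?thesis by linarith
qed

text \<open>The zero at \<open>z\<close> starts the induction; the step uses
  \<open>3 \<bar>J (q\<^bsup>n+1\<^esup> z)\<bar> - \<bar>J (q\<^sup>n z)\<bar> \<ge> 2 \<bar>J (q\<^bsup>n+1\<^esup> z)\<bar>\<close>.\<close>

lemma doubling_step:
  assumes "z > 0" "J z = 0" "q ^ n * z \<ge> threshold"
  shows "2 * \<bar>J (q ^ n * z)\<bar> \<le> \<bar>J (q ^ Suc n * z)\<bar>"
  using assms(3)
proof (induction n)
  case 0
  then show ?case using assms by simp
next
  case (Suc n)
  have "q * (q ^ n * z) \<le> 1 * (q ^ n * z)"
    using q assms(1) by (intro mult_right_mono) auto
  then have "q ^ n * z \<ge> threshold" using Suc.prems by simp
  then have IH: "2 * \<bar>J (q ^ n * z)\<bar> \<le> \<bar>J (q ^ Suc n * z)\<bar>" by (rule Suc.IH)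
  have "\<bar>J (q\<^sup>2 * (q ^ n * z))\<bar> \<ge> 3 * \<bar>J (q * (q ^ n * z))\<bar> - \<bar>J (q ^ n * z)\<bar>"
    using Suc.prems q assms(1) by (intro three_term_growth) (auto simp: mult_ac)
  then show ?case using IH by (simp add: power2_eq_square mult_ac)
qed

lemma doubling:
  assumes "z > 0" "J z = 0" "\<And>i. i < d \<Longrightarrow> q ^ (n + i) * z \<ge> threshold"
  shows "2 ^ d * \<bar>J (q ^ n * z)\<bar> \<le> \<bar>J (q ^ (n + d) * z)\<bar>"
  using assms(3)
proof (induction d)
  case (Suc d)
  have "2 ^ d * \<bar>J (q ^ n * z)\<bar> \<le> \<bar>J (q ^ (n + d) * z)\<bar>"
    using Suc by simp
  moreover have "2 * \<bar>J (q ^ (n + d) * z)\<bar> \<le> \<bar>J (q ^ Suc (n + d) * z)\<bar>"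
    using Suc.prems assms by (intro doubling_step) auto
  ultimately show ?case by simp
qed simp

text \<open>Let \<open>R\<close> be the threshold. The progression \<open>q\<^sup>n z\<close> falls below the threshold for the first time at some index, and then
  it lies in \<open>[q R, R]\<close>, where \<open>J\<close> is bounded. All earlier values are smaller by \<open>doubling\<close>.\<close>

lemma bounded_above_threshold:
  obtains M where "M \<ge> 0"
    "\<And>z n d. \<lbrakk>z > 0; J z = 0; q ^ (n + d) * z \<ge> threshold\<rbrakk> \<Longrightarrow> 2 ^ d * \<bar>J (q ^ n * z)\<bar> \<le> M"
proof -
  let ?R = threshold
  obtain C where C: "\<And>u. 0 < u \<Longrightarrow> u \<le> ?R \<Longrightarrow> \<bar>J u\<bar> \<le> C * u powr \<nu>"
    using locally_bounded by blast
  define M where "M = \<bar>C\<bar> * ((q * ?R) powr \<nu> + ?R powr \<nu>)"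
  have M: "\<bar>J u\<bar> \<le> M" if "q * ?R \<le> u" "u \<le> ?R" for u
  proof -
    have "0 < q * ?R" using q threshold_pos by simp
    with that have "u > 0" by linarith
    have "u powr \<nu> \<le> (q * ?R) powr \<nu> + ?R powr \<nu>"
    proof (cases "\<nu> \<ge> 0")
      case True
      then have "u powr \<nu> \<le> ?R powr \<nu>" using that \<open>u > 0\<close> by (intro powr_mono2) auto
      then show ?thesis by (simp add: add_increasing)
    next
      case False
      then have "u powr \<nu> \<le> (q * ?R) powr \<nu>" using that \<open>0 < q * ?R\<close> by (intro powr_mono2') auto
      then show ?thesis by (simp add: add_increasing2)
    qed
    then have "\<bar>C\<bar> * u powr \<nu> \<le> M" unfolding M_def by (intro mult_left_mono) auto
    moreover have "C * u powr \<nu> \<le> \<bar>C\<bar> * u powr \<nu>" by (intro mult_right_mono) auto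
    ultimately show ?thesis using C[OF \<open>u > 0\<close> that(2)] by linarith
  qed
  have bound: "2 ^ d * \<bar>J (q ^ n * z)\<bar> \<le> M"
    if z: "z > 0" "J z = 0" and ge: "q ^ (n + d) * z \<ge> ?R" for z n d
  proof -
    have dec: "q ^ i * z \<le> q ^ k * z" if "k \<le> i" for i k
      using q z that by (intro mult_right_mono power_decreasing) auto
    have "(\<lambda>i. q ^ i * z) \<longlonglongrightarrow> 0 * z"
      using q by (intro tendsto_intros LIMSEQ_power_zero) auto
    then have "eventually (\<lambda>i. q ^ i * z < ?R) sequentially"
      using threshold_pos by (intro order_tendstoD(2)) auto
    then have ex: "\<exists>i. q ^ i * z < ?R" by (auto simp: eventually_sequentially)
    define e where "e = (LEAST i. q ^ i * z < ?R)"
    have e: "q ^ e * z < ?R" unfolding e_def using ex by (rule LeastI_ex)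
    have before: "q ^ i * z \<ge> ?R" if "i < e" for i
      using not_less_Least[of i "\<lambda>i. q ^ i * z < ?R"] that by (simp add: e_def not_less)
    have "n + d < e"
      using dec[of e "n + d"] e ge by (metis dec not_less order.strict_trans2)
    then have "e > 0" by simp
    have "q * ?R \<le> q * (q ^ (e - 1) * z)"
      using before[of "e - 1"] \<open>e > 0\<close> q by (intro mult_left_mono) auto
    also have "\<dots> = q ^ e * z" using \<open>e > 0\<close> by (cases e) auto
    finally have "\<bar>J (q ^ e * z)\<bar> \<le> M" using e by (intro M) auto
    moreover have "2 ^ (e - n) * \<bar>J (q ^ n * z)\<bar> \<le> \<bar>J (q ^ (n + (e - n)) * z)\<bar>"
      by (intro doubling z before) simp
    moreover have "2 ^ d * \<bar>J (q ^ n * z)\<bar> \<le> 2 ^ (e - n) * \<bar>J (q ^ n * z)\<bar>"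
      using \<open>n + d < e\<close> by (intro mult_right_mono power_increasing) auto
    ultimately show ?thesis using \<open>n + d < e\<close> by simp
  qed
  have "M \<ge> 0" by (simp add: M_def)
  with bound that show ?thesis by blast
qed

lemma uniform_bound_at_zeros:
  obtains K where "K \<ge> 0"
    "\<And>z n. \<lbrakk>z \<ge> 1; J z = 0\<rbrakk> \<Longrightarrow> \<bar>J (q ^ n * z)\<bar> \<le> K * (1 + q powr (\<nu> * n))"
proof -
  let ?R = threshold
  obtain M where M: "M \<ge> 0"
    "\<And>z n d. \<lbrakk>z > 0; J z = 0; q ^ (n + d) * z \<ge> ?R\<rbrakk> \<Longrightarrow> 2 ^ d * \<bar>J (q ^ n * z)\<bar> \<le> M"
    using bounded_above_threshold by blast
  obtain C where C: "\<And>u. 0 < u \<Longrightarrow> u \<le> ?R \<Longrightarrow> \<bar>J u\<bar> \<le> C * u powr \<nu>"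
    using locally_bounded by blast
  define K where "K = M + \<bar>C\<bar> * (1 + ?R powr \<nu>)"
  have "K \<ge> 0" using M(1) by (simp add: K_def add_nonneg_nonneg)
  have "\<bar>J (q ^ n * z)\<bar> \<le> K * (1 + q powr (\<nu> * n))" if z: "z \<ge> 1" "J z = 0" for z n
  proof (cases "q ^ n * z \<ge> ?R")
    case True
    then have "\<bar>J (q ^ n * z)\<bar> \<le> M" using M(2)[of z n 0] z by simp
    also have "M \<le> K" by (simp add: K_def)
    also have "K * 1 \<le> K * (1 + q powr (\<nu> * n))"
      using \<open>K \<ge> 0\<close> by (intro mult_left_mono) auto
    finally show ?thesis by simp
  next
    case False
    let ?u = "q ^ n * z"
    have "?u > 0" using q z by simp
    have "?u powr \<nu> \<le> (1 + ?R powr \<nu>) * (1 + q powr (\<nu> * n))"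
    proof (cases "\<nu> \<ge> 0")
      case True
      then have "?u powr \<nu> \<le> ?R powr \<nu>"
        using False \<open>?u > 0\<close> by (intro powr_mono2) auto
      then show ?thesis by (simp add: algebra_simps add_increasing add_increasing2)
    next
      \<comment> \<open>For negative \<open>\<nu>\<close> this is where \<open>z \<ge> 1\<close> enters, in the form \<open>q\<^sup>n z \<ge> q\<^sup>n\<close>.\<close>
      case neg: False
      have "q ^ n * 1 \<le> ?u" using q z by (intro mult_left_mono) auto
      then have "?u powr \<nu> \<le> (q ^ n) powr \<nu>" using neg q by (intro powr_mono2') auto
      also have "(q ^ n) powr \<nu> = q powr (\<nu> * n)"
        using q by (simp add: powr_realpow[symmetric] powr_powr mult.commute)
      finally show ?thesis by (simp add: algebra_simps add_increasing add_increasing2)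
    qed
    then have "\<bar>C\<bar> * ?u powr \<nu> \<le> \<bar>C\<bar> * ((1 + ?R powr \<nu>) * (1 + q powr (\<nu> * n)))"
      by (intro mult_left_mono) auto
    also have "\<dots> \<le> K * (1 + q powr (\<nu> * n))"
      unfolding K_def mult.assoc[symmetric] using M(1) by (intro mult_right_mono) auto
    finally have "\<bar>C\<bar> * ?u powr \<nu> \<le> K * (1 + q powr (\<nu> * n))" .
    moreover have "C * ?u powr \<nu> \<le> \<bar>C\<bar> * ?u powr \<nu>" by (intro mult_right_mono) auto
    moreover have "\<bar>J ?u\<bar> \<le> C * ?u powr \<nu>" using C \<open>?u > 0\<close> False by simp
    ultimately show ?thesis by linarith
  qed
  with \<open>K \<ge> 0\<close> that show ?thesis by blast
qed

text \<open>For large \<open>z\<close>, at least \<open>d\<close> doublings separate \<open>q\<^sup>n z\<close> from the threshold.\<close>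

lemma tendsto_0_at_zeros:
  assumes lim: "filterlim z at_top F" and zero: "eventually (\<lambda>m. J (z m) = 0) F"
  shows "((\<lambda>m. J (q ^ n * z m)) \<longlongrightarrow> 0) F"
proof (rule tendstoI)
  fix \<epsilon> :: real assume "\<epsilon> > 0"
  obtain M where M: "M \<ge> 0"
    "\<And>z n d. \<lbrakk>z > 0; J z = 0; q ^ (n + d) * z \<ge> threshold\<rbrakk> \<Longrightarrow> 2 ^ d * \<bar>J (q ^ n * z)\<bar> \<le> M"
    using bounded_above_threshold by blast
  obtain d :: nat where d: "M / \<epsilon> < 2 ^ d"
    using real_arch_pow[of 2 "M / \<epsilon>"] by auto
  have "eventually (\<lambda>m. z m \<ge> threshold / q ^ (n + d)) F"
    using lim by (simp add: filterlim_at_top)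
  moreover have "eventually (\<lambda>m. z m \<ge> 1) F"
    using lim by (simp add: filterlim_at_top)
  ultimately show "eventually (\<lambda>m. dist (J (q ^ n * z m)) 0 < \<epsilon>) F"
    using zero
  proof eventually_elim
    case (elim m)
    have "q ^ (n + d) * z m \<ge> threshold"
      using elim(1) q by (simp add: pos_divide_le_eq mult.commute)
    then have "2 ^ d * \<bar>J (q ^ n * z m)\<bar> \<le> M" using M(2) elim by simp
    also have "M < 2 ^ d * \<epsilon>" using d \<open>\<epsilon> > 0\<close> by (simp add: pos_divide_less_eq)
    finally show ?case by simp
  qed
qed

text \<open>A dominated-convergence argument; boundedness of \<open>a\<close> is enough because \<open>\<nu> > -1\<close> makes the
  dominating sequence a sum of two convergent geometric series.\<close>

lemma weighted_series_tendsto_0: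
  fixes a :: "nat \<Rightarrow> complex"
  assumes \<nu>: "\<nu> > -1" and a: "Bseq a"
    and lim: "filterlim z at_top sequentially" and zero: "eventually (\<lambda>m. J (z m) = 0) sequentially"
  shows "(\<lambda>m. \<Sum>k. a k * of_real (q ^ k * J (q ^ Suc k * z m))) \<longlonglongrightarrow> 0"
proof -
  obtain A where A: "A > 0" "\<And>k. norm (a k) \<le> A" using a by (auto simp: Bseq_def)
  obtain K where K: "K \<ge> 0"
    "\<And>z n. \<lbrakk>z \<ge> 1; J z = 0\<rbrakk> \<Longrightarrow> \<bar>J (q ^ n * z)\<bar> \<le> K * (1 + q powr (\<nu> * n))"
    using uniform_bound_at_zeros by blast
  define D where "D k = A * (K * (q ^ k + q powr \<nu> * (q powr (1 + \<nu>)) ^ k))" for k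
  have "q powr (1 + \<nu>) < 1" using q \<nu> by (simp add: powr01_less_one)
  then have "summable D"
    unfolding D_def using q by (intro summable_mult summable_add summable_geometric) auto
  have "eventually (\<lambda>m. z m \<ge> 1) sequentially"
    using lim by (simp add: filterlim_at_top)
  then have "eventually (\<lambda>m. z m \<ge> 1 \<and> J (z m) = 0) sequentially"
    using zero by eventually_elim auto
  then have "eventually (\<lambda>(k::nat, m). z m \<ge> 1 \<and> J (z m) = 0) (at_top \<times>\<^sub>F sequentially)"
    by (subst eventually_prod2) simp_all
  then have "eventually (\<lambda>(k, m). norm (a k * of_real (q ^ k * J (q ^ Suc k * z m))) \<le> D k)
               (at_top \<times>\<^sub>F sequentially)"
  proof (rule eventually_mono, clarify)
    fix k m assume z: "z m \<ge> 1" "J (z m) = 0"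
    have "q ^ k = q powr real k" using q by (simp add: powr_realpow)
    moreover have "(q powr (1 + \<nu>)) ^ k = q powr ((1 + \<nu>) * real k)"
      using q powr_realpow[of "q powr (1 + \<nu>)" k] by (simp add: powr_powr)
    moreover have "real k + \<nu> * real (Suc k) = \<nu> + (1 + \<nu>) * real k"
      by (simp add: algebra_simps)
    ultimately have "q ^ k * q powr (\<nu> * Suc k) = q powr \<nu> * (q powr (1 + \<nu>)) ^ k"
      by (simp only: powr_add [symmetric])
    then have "q ^ k * (K * (1 + q powr (\<nu> * Suc k))) = K * (q ^ k + q powr \<nu> * (q powr (1 + \<nu>)) ^ k)"
      by (simp only: distrib_left mult_1_right mult.left_commute[of "q ^ k" K] mult.commute[of "q ^ k" K])
    moreover have "q ^ k * \<bar>J (q ^ Suc k * z m)\<bar> \<le> q ^ k * (K * (1 + q powr (\<nu> * Suc k)))"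
      using q by (intro mult_left_mono K(2) z) auto
    ultimately have "q ^ k * \<bar>J (q ^ Suc k * z m)\<bar>
                       \<le> K * (q ^ k + q powr \<nu> * (q powr (1 + \<nu>)) ^ k)" by (simp only:)
    then have "A * (q ^ k * \<bar>J (q ^ Suc k * z m)\<bar>) \<le> D k"
      unfolding D_def using A(1) by (intro mult_left_mono) auto
    moreover have "norm (a k * of_real (q ^ k * J (q ^ Suc k * z m)))
                     \<le> A * (q ^ k * \<bar>J (q ^ Suc k * z m)\<bar>)"
      unfolding norm_mult norm_of_real abs_mult using A q by (intro mult_mono) auto
    ultimately show "norm (a k * of_real (q ^ k * J (q ^ Suc k * z m))) \<le> D k" by linarith
  qed
  moreover have "(\<lambda>m. a k * of_real (q ^ k * J (q ^ Suc k * z m))) \<longlonglongrightarrow> a k * of_real (q ^ k * 0)" for k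
    by (intro tendsto_intros tendsto_0_at_zeros lim zero)
  ultimately have "(\<lambda>m. \<Sum>k. a k * of_real (q ^ k * J (q ^ Suc k * z m))) \<longlonglongrightarrow> (\<Sum>k. a k * of_real (q ^ k * 0))"
    using tannerys_theorem[of "\<lambda>k m. a k * of_real (q ^ k * J (q ^ Suc k * z m))"
            "\<lambda>k. a k * of_real (q ^ k * 0)" sequentially D] \<open>summable D\<close> by auto
  then show ?thesis by simp
qed

end

section \<open>The zeros of the Hahn--Exton function\<close>

context
  fixes q \<nu> :: real
  assumes q: "0 < q" "q < 1" and \<nu>: "\<nu> > -1"
begin

lemma he_parameter: "0 < q powr (2 * (\<nu> + 1))" "q powr (2 * (\<nu> + 1)) < 1"
  using q \<nu> by (simp_all add: powr01_less_one)

text \<open>The prefactor \<open>z powr \<nu>\<close> turns the asymmetric equation for the power series into the symmetric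
  one, in which \<open>J u\<close> and \<open>J (q\<^sup>2 u)\<close> have equal weight.\<close>

lemma q_bessel_equation_hahn_exton: "q_bessel_equation q \<nu> (hahn_exton q \<nu>)"
proof
  show "0 < q" "q < 1" by fact+
next
  fix u :: real assume u: "u > 0"
  define b where "b = q powr (2 * (\<nu> + 1))"
  define s where "s = q powr \<nu>"
  have s: "s > 0" using q by (simp add: s_def)
  have b_eq: "b / q\<^sup>2 = s\<^sup>2"
  proof -
    have "b = q powr (\<nu> + \<nu> + 2)" by (simp add: b_def algebra_simps)
    also have "\<dots> = s * s * q powr 2" by (simp only: powr_add s_def)
    also have "q powr 2 = q\<^sup>2" using q by simp
    finally show ?thesis using q by (simp add: power2_eq_square)
  qed
  let ?H = "he_series q b" and ?k = "u powr \<nu> * he_const q \<nu>"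
  have E: "?H (u\<^sup>2) + s\<^sup>2 * ?H (q ^ 4 * u\<^sup>2) = (1 + s\<^sup>2 - q\<^sup>2 * u\<^sup>2) * ?H (q\<^sup>2 * u\<^sup>2)"
    using he_series_q_difference[OF q he_parameter, folded b_def, of "u\<^sup>2"] by (simp add: b_eq)
  have J0: "hahn_exton q \<nu> u = ?k * ?H (u\<^sup>2)"
    by (simp add: hahn_exton_eq b_def)
  have J1: "hahn_exton q \<nu> (q * u) = s * ?k * ?H (q\<^sup>2 * u\<^sup>2)"
    using q u by (simp add: hahn_exton_eq b_def s_def powr_mult power_mult_distrib)
  have "(q\<^sup>2) powr \<nu> = s\<^sup>2"
    using q by (simp add: power2_eq_square powr_mult s_def)
  then have J2: "hahn_exton q \<nu> (q\<^sup>2 * u) = s\<^sup>2 * ?k * ?H (q ^ 4 * u\<^sup>2)"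
    using q u by (simp add: hahn_exton_eq b_def powr_mult power_mult_distrib power_mult[symmetric])
  have "hahn_exton q \<nu> u + hahn_exton q \<nu> (q\<^sup>2 * u) = ?k * (?H (u\<^sup>2) + s\<^sup>2 * ?H (q ^ 4 * u\<^sup>2))"
    unfolding J0 J2 by (simp add: algebra_simps)
  also have "\<dots> = (s + inverse s - inverse s * (q * u)\<^sup>2) * (s * ?k * ?H (q\<^sup>2 * u\<^sup>2))"
    unfolding E using s by (simp add: field_simps power2_eq_square)
  finally show "hahn_exton q \<nu> u + hahn_exton q \<nu> (q\<^sup>2 * u) =
      (q powr \<nu> + q powr -\<nu> - q powr -\<nu> * (q * u)\<^sup>2) * hahn_exton q \<nu> (q * u)"
    by (simp add: J1 s_def powr_minus)
next
  fix R :: real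
  define b where "b = q powr (2 * (\<nu> + 1))"
  have "compact (he_series q b ` {0..R\<^sup>2})"
    using he_parameter by (intro compact_continuous_image continuous_on_he_series q) (auto simp: b_def)
  then obtain B where B: "\<And>x. x \<in> {0..R\<^sup>2} \<Longrightarrow> \<bar>he_series q b x\<bar> \<le> B"
    using compact_imp_bounded by (force simp: bounded_iff)
  have "\<bar>hahn_exton q \<nu> u\<bar> \<le> \<bar>he_const q \<nu>\<bar> * B * u powr \<nu>" if "0 < u \<and> u \<le> R" for u
  proof -
    have "\<bar>he_series q b (u\<^sup>2)\<bar> \<le> B" using that by (intro B) (auto intro: power_mono)
    then have "u powr \<nu> * \<bar>he_const q \<nu>\<bar> * \<bar>he_series q b (u\<^sup>2)\<bar> \<le> u powr \<nu> * \<bar>he_const q \<nu>\<bar> * B"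
      by (intro mult_left_mono) auto
    then show ?thesis by (simp add: hahn_exton_eq b_def abs_mult mult_ac)
  qed
  then show "\<exists>C. \<forall>u. 0 < u \<and> u \<le> R \<longrightarrow> \<bar>hahn_exton q \<nu> u\<bar> \<le> C * u powr \<nu>" by blast
qed

lemma finite_zeros_hahn_exton:
  assumes "he_const q \<nu> \<noteq> 0"
  shows "finite {z. 0 < z \<and> z \<le> B \<and> hahn_exton q \<nu> z = 0}"
proof -
  let ?b = "q powr (2 * (\<nu> + 1))"
  have "finite {x. \<bar>x\<bar> \<le> B\<^sup>2 \<and> he_series q ?b x = 0}"
    by (rule finite_zeros_he_series[OF q he_parameter])
  moreover have "(\<lambda>z. z\<^sup>2) ` {z. 0 < z \<and> z \<le> B \<and> hahn_exton q \<nu> z = 0}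
                   \<subseteq> {x. \<bar>x\<bar> \<le> B\<^sup>2 \<and> he_series q ?b x = 0}"
    using assms by (auto simp: hahn_exton_eq intro: power_mono)
  moreover have "inj_on (\<lambda>z::real. z\<^sup>2) {z. 0 < z \<and> z \<le> B \<and> hahn_exton q \<nu> z = 0}"
    by (auto simp: inj_on_def)
  ultimately show ?thesis by (meson finite_imageD finite_subset)
qed

lemma zeros_tendsto_infinity:
  fixes j :: "nat \<Rightarrow> real"
  assumes mono: "strict_mono_on {1..} j"
    and zeros: "j ` {1..} = {z. z > 0 \<and> hahn_exton q \<nu> z = 0}"
  shows "filterlim j at_top sequentially"
proof -
  have least: "j 1 \<le> z" if "z > 0" "hahn_exton q \<nu> z = 0" for z
  proof -
    have "z \<in> j ` {1..}" unfolding zeros using that by simp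
    then obtain n where "n \<ge> 1" "z = j n" by auto
    show ?thesis
    proof (cases "n = 1")
      case False
      then have "j 1 < j n" using \<open>n \<ge> 1\<close> by (intro strict_mono_onD[OF mono]) auto
      then show ?thesis using \<open>z = j n\<close> by simp
    qed (use \<open>z = j n\<close> in simp)
  qed
  have "j 1 \<in> j ` {1..}" by simp
  then have j1: "j 1 > 0" unfolding zeros by simp
  have const: "he_const q \<nu> \<noteq> 0"
  proof
    assume "he_const q \<nu> = 0"
    then have "j 1 \<le> j 1 / 2" using j1 by (intro least) (auto simp: hahn_exton_eq)
    then show False using j1 by simp
  qed
  show ?thesis unfolding filterlim_at_top
  proof
    fix B :: real
    have "finite (j ` {m. m \<ge> 1 \<and> j m \<le> B})"
      by (rule finite_subset[OF _ finite_zeros_hahn_exton[OF const, of B]]) (use zeros in blast)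
    moreover have "inj_on j {m. m \<ge> 1 \<and> j m \<le> B}"
      using strict_mono_on_imp_inj_on[OF mono] by (rule inj_on_subset) auto
    ultimately have "finite {m. m \<ge> 1 \<and> j m \<le> B}" by (rule finite_imageD)
    then have "eventually (\<lambda>m. \<not> (m \<ge> 1 \<and> j m \<le> B)) sequentially"
      unfolding cofinite_eq_sequentially[symmetric] by (simp add: eventually_cofinite)
    then show "eventually (\<lambda>m. B \<le> j m) sequentially"
      using eventually_ge_at_top[of 1] by eventually_elim auto
  qed
qed

end

section \<open>The limit of the \<open>q\<close>-integrals\<close>

text \<open>The square of the weight \<open>t powr (1/2)\<close> and the mass \<open>q\<^sup>k\<close> of the point \<open>q\<^sup>k\<close> contribute one factor
  \<open>q\<^sup>k\<close> each, so the summable terms are \<open>\<bar>q\<^sup>k f (q\<^sup>k)\<bar>\<^sup>2\<close>.\<close>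

lemma Bseq_of_Lq2:
  assumes "0 < q" and "(\<lambda>t. of_real (t powr (1/2)) * f t) \<in> Lq2 q"
  shows "Bseq (\<lambda>k. of_real (q ^ k) * f (q ^ k))"
proof -
  have "(cmod (of_real ((q ^ k) powr (1/2)) * f (q ^ k)))\<^sup>2 * q ^ k
          = (cmod (of_real (q ^ k) * f (q ^ k)))\<^sup>2" for k
  proof -
    have "((q ^ k) powr (1/2))\<^sup>2 = q ^ k" using assms(1) by (simp add: powr_half_sqrt)
    then show ?thesis
      using assms(1) by (simp only: norm_mult norm_of_real power_mult_distrib power2_abs)
        (simp add: power2_eq_square)
  qed
  then have "summable (\<lambda>k. (cmod (of_real (q ^ k) * f (q ^ k)))\<^sup>2)"
    using assms(2) by (simp add: Lq2_def)
  then have "(\<lambda>k. sqrt ((cmod (of_real (q ^ k) * f (q ^ k)))\<^sup>2)) \<longlonglongrightarrow> sqrt 0"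
    by (intro tendsto_real_sqrt summable_LIMSEQ_zero)
  then have "(\<lambda>k. of_real (q ^ k) * f (q ^ k)) \<longlonglongrightarrow> 0"
    by (subst tendsto_norm_zero_iff[symmetric]) simp
  then show ?thesis by (blast intro: convergent_imp_Bseq convergentI)
qed

theorem theorem4p1:
  fixes q \<nu> :: real and j :: "nat \<Rightarrow> real" and f :: "real \<Rightarrow> complex"
  assumes "0 < q" and "q < 1" and "\<nu> > -1"
    and "strict_mono_on {1..} j"
    and "j ` {1..} = {z. z > 0 \<and> hahn_exton q \<nu> z = 0}"
    and "(\<lambda>t. of_real (t powr (1/2)) * f t) \<in> Lq2 q"
  shows "(\<lambda>m. q_integral q (\<lambda>t. of_real t * f t * of_real (hahn_exton q \<nu> (q * j m * t)))) \<longlonglongrightarrow> 0"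
proof -
  interpret q_bessel_equation q \<nu> "hahn_exton q \<nu>"
    using assms(1-3) by (rule q_bessel_equation_hahn_exton)
  define a where "a k = of_real (q ^ k) * f (q ^ k)" for k
  have "Bseq a" unfolding a_def using assms(1,6) by (rule Bseq_of_Lq2)
  moreover have "filterlim j at_top sequentially"
    using assms(1-5) by (rule zeros_tendsto_infinity)
  moreover have "hahn_exton q \<nu> (j m) = 0" if "m \<ge> 1" for m
    using assms(5) that by blast
  then have "eventually (\<lambda>m. hahn_exton q \<nu> (j m) = 0) sequentially"
    by (auto simp: eventually_sequentially)
  ultimately have "(\<lambda>m. \<Sum>k. a k * of_real (q ^ k * hahn_exton q \<nu> (q ^ Suc k * j m))) \<longlonglongrightarrow> 0"
    using assms(3) by (intro weighted_series_tendsto_0)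
  then have "(\<lambda>m. of_real (1 - q) * (\<Sum>k. a k * of_real (q ^ k * hahn_exton q \<nu> (q ^ Suc k * j m))))
               \<longlonglongrightarrow> of_real (1 - q) * 0"
    by (intro tendsto_intros)
  then show ?thesis by (simp add: q_integral_def a_def mult_ac)
qed

end
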